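(* Let $I\subseteq\mathbb{R}$ be an interval and let $a,b,c,f_4\in C^\infty(I)$ be real-valued with $c(x)\neq0$ on $I$. Suppose that for all $x\in I$ $$a(x)=\frac{1}{4c(x)}\left[2c(x)\frac{d}{dx}\left(\frac{f_4}{c}\right)(x)-f_4^2(x)-2b(x)f_4(x)\right].$$ Then the general solution of the Riccati equation $\frac{dy}{dx}=a(x)+b(x)y+c(x)y^2$ is $$y(x)=\frac{e^{\int^{x}[b(\phi)+f_4(\phi)]\,d\phi}}{C_{10}-\int^{x}c(\psi)\,e^{\int^{\psi}[b(\phi)+f_4(\phi)]\,d\phi}\,d\psi}+\frac{f_4(x)}{2c(x)},$$ where $C_{10}$ is an arbitrary constant of integration.
   Context: $\int^{x}g(\phi)\,d\phi$ denotes a fixed antiderivative of $g$ on $I$, the same one wherever the same integrand occurs. "The general solution is $y(x)=\frac{G(x)}{C-H(x)}+y_p(x)$ with $C$ an arbitrary constant" means: for every real $C$, this function satisfies the equation on every subinterval of $I$ on which $C-H$ does not vanish; and conversely every differentiable solution on a nondegenerate subinterval of $I$ is either of this form for some real $C$ (with nonvanishing denominator there) or equal to $y_p$ (the limiting case $C=\infty$). *)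

theory Defs
  imports "HOL-Analysis.Analysis"
begin

text \<open>Derivatives are taken within the interval, hence one-sided at an endpoint belonging to it.\<close>

definition smooth_on :: "real set \<Rightarrow> (real \<Rightarrow> real) \<Rightarrow> bool" where
  "smooth_on I f \<longleftrightarrow>
     (\<exists>D :: nat \<Rightarrow> real \<Rightarrow> real. (\<forall>x\<in>I. D 0 x = f x) \<and>
        (\<forall>n. \<forall>x\<in>I. (D n has_real_derivative D (Suc n) x) (at x within I)))"

definition antiderivative_on :: "real set \<Rightarrow> (real \<Rightarrow> real) \<Rightarrow> (real \<Rightarrow> real) \<Rightarrow> bool" where
  "antiderivative_on I g A \<longleftrightarrow> (\<forall>x\<in>I. (A has_real_derivative g x) (at x within I))"

definition riccati_solution_on ::
  "real set \<Rightarrow> (real \<Rightarrow> real) \<Rightarrow> (real \<Rightarrow> real) \<Rightarrow> (real \<Rightarrow> real) \<Rightarrow> (real \<Rightarrow> real) \<Rightarrow> bool" where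
  "riccati_solution_on J a b c y \<longleftrightarrow>
     (\<forall>x\<in>J. (y has_real_derivative (a x + b x * y x + c x * (y x)\<^sup>2)) (at x within J))"

text \<open>
  \<open>y = G / (C - H) + y\<^sub>p\<close> with arbitrary constant \<open>C\<close> is the general solution on \<open>I\<close>;
  the second disjunct of the converse is the limiting case of infinite \<open>C\<close>.
\<close>

definition riccati_general_solution ::
  "real set \<Rightarrow> (real \<Rightarrow> real) \<Rightarrow> (real \<Rightarrow> real) \<Rightarrow> (real \<Rightarrow> real) \<Rightarrow>
   (real \<Rightarrow> real) \<Rightarrow> (real \<Rightarrow> real) \<Rightarrow> (real \<Rightarrow> real) \<Rightarrow> bool" where
  "riccati_general_solution I a b c G H y\<^sub>p \<longleftrightarrow>
     (\<forall>C J. is_interval J \<and> J \<subseteq> I \<and> (\<forall>x\<in>J. C - H x \<noteq> 0) \<longrightarrow>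
        riccati_solution_on J a b c (\<lambda>x. G x / (C - H x) + y\<^sub>p x)) \<and>
     (\<forall>J y. is_interval J \<and> J \<subseteq> I \<and> (\<exists>s\<in>J. \<exists>t\<in>J. s \<noteq> t) \<and> riccati_solution_on J a b c y \<longrightarrow>
        (\<exists>C. \<forall>x\<in>J. C - H x \<noteq> 0 \<and> y x = G x / (C - H x) + y\<^sub>p x) \<or>
        (\<forall>x\<in>J. y x = y\<^sub>p x))"

end

theory Submission
  imports Defs
begin

text \<open>
  The relation imposed on \<open>a\<close> says precisely that \<open>y\<^sub>p = f\<^sub>4 / (2 c)\<close> solves the Riccati
  equation: the right-hand side evaluated at \<open>y\<^sub>p\<close> collapses to \<open>(f\<^sub>4 / c)' / 2\<close>
  (lemma \<open>half_quotient_solves_riccati\<close>).  The rest is the classical integration of a Riccati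
  equation from one known solution, carried out in \<open>riccati_general_solution_from_particular\<close>.

  For a solution \<open>y\<close>, the difference \<open>u = y - y\<^sub>p\<close> satisfies the Bernoulli equation
  \<open>u' = (b + 2 c y\<^sub>p) u + c u\<^sup>2\<close>, and \<open>2 c y\<^sub>p = f\<^sub>4\<close>.  If \<open>E' = b + 2 c y\<^sub>p\<close>, then
  \<open>w = u e\<^sup>-\<^sup>E\<close> satisfies \<open>w' = c e\<^sup>E w\<^sup>2 = H' w\<^sup>2\<close>, so formally \<open>1 / w = C - H\<close>.  Since a
  solution might a priori vanish at some points only, the converse avoids dividing by \<open>w\<close>:
  choose a point where \<open>w \<noteq> 0\<close> and let \<open>C\<close> be the value of \<open>H + 1 / w\<close> there.  The defect
  \<open>g = w (C - H) - 1\<close> vanishes at this point and satisfies the homogeneous linear equation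
  \<open>g' = c u g\<close>, whose coefficient \<open>c u\<close> is continuous.  By uniqueness (lemma
  \<open>homogeneous_linear_ode_zero\<close>) it vanishes throughout, which gives both \<open>C - H \<noteq> 0\<close> and the
  formula.  If there is no such point, \<open>y = y\<^sub>p\<close>.
\<close>

text \<open>
  Multiplying by the integrating factor \<open>e\<^sup>-\<^sup>K\<close>, with \<open>K' = k\<close>, makes \<open>z\<close> constant.  As \<open>J\<close> may
  be neither closed nor bounded, \<open>K\<close> is taken on the compact segment between the two points.
\<close>

lemma homogeneous_linear_ode_zero:
  fixes z k :: "real \<Rightarrow> real"
  assumes J: "is_interval J" and cont: "continuous_on J k"
    and ode: "\<And>x. x \<in> J \<Longrightarrow> (z has_real_derivative k x * z x) (at x within J)"
    and s: "s \<in> J" "z s = 0" and t: "t \<in> J"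
  shows "z t = 0"
proof -
  define p q where "p = min s t" and "q = max s t"
  have sub: "{p..q} \<subseteq> J"
  proof
    fix x assume "x \<in> {p..q}"
    moreover have "p \<in> J" "q \<in> J"
      using s(1) t by (simp_all add: p_def q_def min_def max_def)
    ultimately show "x \<in> J"
      using mem_is_interval_1_I[OF J, of p q x] by simp
  qed
  define K where "K = (\<lambda>x. integral {p..x} k)"
  have "((\<lambda>x. z x * exp (- K x)) has_real_derivative 0) (at x within {p..q})"
    if "x \<in> {p..q}" for x
  proof -
    have K: "(K has_real_derivative k x) (at x within {p..q})"
      unfolding K_def using integral_has_real_derivative continuous_on_subset[OF cont sub] that by blast
    have z: "(z has_real_derivative k x * z x) (at x within {p..q})"
      using DERIV_subset[OF ode sub] sub that by blast
    show ?thesis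
      by (rule derivative_eq_intros K z refl)+ (simp add: algebra_simps)
  qed
  from has_field_derivative_zero_constant[OF convex_real_interval(5) this]
  obtain d where d: "\<And>x. x \<in> {p..q} \<Longrightarrow> z x * exp (- K x) = d"
    by blast
  have "s \<in> {p..q}" "t \<in> {p..q}"
    by (auto simp: p_def q_def)
  then have "z t * exp (- K t) = z s * exp (- K s)"
    using d by simp
  then show ?thesis
    using s(2) by simp
qed

text \<open>
  Subtracting a particular solution \<open>y\<^sub>p\<close> from \<open>y\<close> removes the inhomogeneity \<open>a\<close>, and the
  integrating factor \<open>e\<^sup>-\<^sup>E\<close> then removes the linear term, which leaves the separable equation
  \<open>w' = H' w\<^sup>2\<close>.  Both steps are reversible.
\<close>

lemma riccati_general_solution_from_particular:
  fixes a b c yp E H :: "real \<Rightarrow> real"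
  assumes c: "continuous_on I c"
    and yp: "riccati_solution_on I a b c yp"
    and E: "antiderivative_on I (\<lambda>x. b x + 2 * c x * yp x) E"
    and H: "antiderivative_on I (\<lambda>x. c x * exp (E x)) H"
  shows "riccati_general_solution I a b c (\<lambda>x. exp (E x)) H yp"
  unfolding riccati_general_solution_def
proof (intro conjI allI impI; elim conjE)
  fix C :: real and J
  assume sub: "J \<subseteq> I" and nz: "\<forall>x\<in>J. C - H x \<noteq> 0"
  show "riccati_solution_on J a b c (\<lambda>x. exp (E x) / (C - H x) + yp x)"
    unfolding riccati_solution_on_def
  proof
    fix x assume x: "x \<in> J"
    have dE: "(E has_real_derivative b x + 2 * c x * yp x) (at x within J)"
      and dH: "(H has_real_derivative c x * exp (E x)) (at x within J)"
      and dyp: "(yp has_real_derivative a x + b x * yp x + c x * (yp x)\<^sup>2) (at x within J)"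
      using E H yp x sub DERIV_subset
      unfolding antiderivative_on_def riccati_solution_on_def by blast+
    define u where "u = exp (E x) / (C - H x)"
    have "((\<lambda>x. exp (E x) / (C - H x)) has_real_derivative
        (exp (E x) * (b x + 2 * c x * yp x) * (C - H x) - exp (E x) * (0 - c x * exp (E x)))
          / ((C - H x) * (C - H x))) (at x within J)"
      using nz x by (intro DERIV_divide DERIV_diff DERIV_const DERIV_chain2[OF DERIV_exp] dE dH) simp
    also have "(exp (E x) * (b x + 2 * c x * yp x) * (C - H x) - exp (E x) * (0 - c x * exp (E x)))
          / ((C - H x) * (C - H x)) = (b x + 2 * c x * yp x) * u + c x * u\<^sup>2"
      using nz x by (simp add: u_def add_divide_distrib power2_eq_square mult_ac)
    finally have "((\<lambda>x. exp (E x) / (C - H x) + yp x) has_real_derivative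
        (b x + 2 * c x * yp x) * u + c x * u\<^sup>2 + (a x + b x * yp x + c x * (yp x)\<^sup>2)) (at x within J)"
      using DERIV_add dyp by blast
    moreover have "(b x + 2 * c x * yp x) * u + c x * u\<^sup>2 + (a x + b x * yp x + c x * (yp x)\<^sup>2)
        = a x + b x * (u + yp x) + c x * (u + yp x)\<^sup>2"
      by (simp add: algebra_simps power2_eq_square)
    ultimately show "((\<lambda>x. exp (E x) / (C - H x) + yp x) has_real_derivative
        a x + b x * (exp (E x) / (C - H x) + yp x) + c x * (exp (E x) / (C - H x) + yp x)\<^sup>2)
        (at x within J)"
      by (simp only: u_def)
  qed
next
  fix J y
  assume J: "is_interval J" and sub: "J \<subseteq> I" and y: "riccati_solution_on J a b c y"
  define w where "w = (\<lambda>x. (y x - yp x) * exp (- E x))"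
  have dE: "(E has_real_derivative b x + 2 * c x * yp x) (at x within J)"
    and dH: "(H has_real_derivative c x * exp (E x)) (at x within J)"
    and dyp: "(yp has_real_derivative a x + b x * yp x + c x * (yp x)\<^sup>2) (at x within J)"
    and dy: "(y has_real_derivative a x + b x * y x + c x * (y x)\<^sup>2) (at x within J)"
    if "x \<in> J" for x
    using E H yp y that sub DERIV_subset
    unfolding antiderivative_on_def riccati_solution_on_def by blast+
  have u_w: "y x - yp x = w x * exp (E x)" for x
    by (simp add: w_def exp_minus)
  have dw: "(w has_real_derivative c x * (y x - yp x) * w x) (at x within J)" if "x \<in> J" for x
    unfolding w_def
    by (rule derivative_eq_intros dE dyp dy refl that)+
       (simp add: algebra_simps power2_eq_square)
  show "(\<exists>C. \<forall>x\<in>J. C - H x \<noteq> 0 \<and> y x = exp (E x) / (C - H x) + yp x) \<or> (\<forall>x\<in>J. y x = yp x)"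
  proof (cases "\<exists>s\<in>J. w s \<noteq> 0")
    case False
    then show ?thesis
      by (auto simp: w_def)
  next
    case True
    then obtain s where s: "s \<in> J" "w s \<noteq> 0"
      by blast
    define C where "C = H s + 1 / w s"
    define g where "g = (\<lambda>x. w x * (C - H x) - 1)"
    have dg: "(g has_real_derivative c x * (y x - yp x) * g x) (at x within J)"
      if "x \<in> J" for x
      unfolding g_def
      by (rule derivative_eq_intros dw dH refl that)+ (simp add: u_w algebra_simps)
    have "continuous_on J (\<lambda>x. c x * (y x - yp x))"
      using continuous_on_subset[OF c sub] DERIV_continuous_on[OF dy] DERIV_continuous_on[OF dyp]
      by (intro continuous_intros)
    moreover have "g s = 0"
      using s(2) by (simp add: g_def C_def)
    ultimately have "g x = 0" if "x \<in> J" for x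
      using homogeneous_linear_ode_zero[OF J _ dg s(1)] that by blast
    then have inverse: "w x * (C - H x) = 1" if "x \<in> J" for x
      using that by (simp add: g_def)
    have "C - H x \<noteq> 0 \<and> y x = exp (E x) / (C - H x) + yp x" if "x \<in> J" for x
    proof
      show nz: "C - H x \<noteq> 0"
        using inverse[OF that] by auto
      have "w x = 1 / (C - H x)"
        using inverse[OF that] nz by (simp add: eq_divide_eq)
      then show "y x = exp (E x) / (C - H x) + yp x"
        using u_w[of x] by simp
    qed
    then show ?thesis
      by blast
  qed
qed

lemma smooth_on_has_derivative:
  assumes "smooth_on I f" "x \<in> I"
  obtains d where "(f has_real_derivative d) (at x within I)"
proof -
  from assms obtain D where D0: "\<forall>x\<in>I. D 0 x = f x"
    and "(D 0 has_real_derivative D (Suc 0) x) (at x within I)"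
    unfolding smooth_on_def by blast
  then have "(f has_real_derivative D (Suc 0) x) (at x within I)"
    using assms(2) by (metis has_field_derivative_transform_within zero_less_one)
  then show ?thesis
    by (rule that)
qed

text \<open>
  The term \<open>b y + c y\<^sup>2\<close> at \<open>y = f / (2 c)\<close> equals \<open>(f\<^sup>2 + 2 b f) / (4 c)\<close>, which
  cancels the last two terms of \<open>a\<close> and leaves half the derivative of \<open>f / c\<close>.
\<close>

lemma half_quotient_solves_riccati:
  fixes a b c f :: "real \<Rightarrow> real"
  assumes c: "smooth_on I c" and f: "smooth_on I f" and nz: "\<forall>x\<in>I. c x \<noteq> 0"
    and a: "\<forall>x\<in>I. a x = 1 / (4 * c x) *
           (2 * c x * vector_derivative (\<lambda>t. f t / c t) (at x within I)
              - (f x)\<^sup>2 - 2 * b x * f x)"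
  shows "riccati_solution_on I a b c (\<lambda>x. f x / (2 * c x))"
  unfolding riccati_solution_on_def
proof
  fix x assume x: "x \<in> I"
  let ?y = "\<lambda>x. f x / (2 * c x)"
  have cx: "c x \<noteq> 0"
    using nz x by blast
  show "(?y has_real_derivative a x + b x * ?y x + c x * (?y x)\<^sup>2) (at x within I)"
  proof (cases "at x within I = bot")
    \<comment> \<open>At an isolated point of \<open>I\<close> the vector derivative has no determined value, but then every number is a
      derivative within \<open>I\<close>.\<close>
    case True
    then show ?thesis
      by (simp add: has_field_derivative_iff)
  next
    case False
    obtain c' f' where c': "(c has_real_derivative c') (at x within I)"
      and f': "(f has_real_derivative f') (at x within I)"
      using smooth_on_has_derivative c f x by metis
    define d where "d = vector_derivative (\<lambda>t. f t / c t) (at x within I)"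
    have quot: "((\<lambda>t. f t / c t) has_real_derivative (f' * c x - f x * c') / (c x * c x)) (at x within I)"
      using DERIV_divide[OF f' c' cx] .
    then have "d = (f' * c x - f x * c') / (c x * c x)"
      unfolding d_def using False
      by (intro vector_derivative_within) (auto simp: has_real_derivative_iff_has_vector_derivative)
    with quot have "((\<lambda>t. f t / c t) has_real_derivative d) (at x within I)"
      by simp
    then have "(?y has_real_derivative d / 2) (at x within I)"
      using DERIV_cdivide[of "\<lambda>t. f t / c t" d x I 2] by (simp add: mult.commute)
    moreover
    have "a x = 1 / (4 * c x) * (2 * c x * d - (f x)\<^sup>2 - 2 * b x * f x)"
      using a x unfolding d_def by blast
    then have "a x + b x * ?y x + c x * (?y x)\<^sup>2 = d / 2"
      using cx by (simp add: field_simps power2_eq_square)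
    ultimately show ?thesis
      by (simp only:)
  qed
qed

theorem theorem7:
  fixes I :: "real set" and a b c f\<^sub>4 E H :: "real \<Rightarrow> real"
  assumes "is_interval I"
    and "smooth_on I a" and "smooth_on I b" and "smooth_on I c" and "smooth_on I f\<^sub>4"
    and "\<forall>x\<in>I. c x \<noteq> 0"
    and "\<forall>x\<in>I. a x = 1 / (4 * c x) *
           (2 * c x * vector_derivative (\<lambda>t. f\<^sub>4 t / c t) (at x within I)
              - (f\<^sub>4 x)\<^sup>2 - 2 * b x * f\<^sub>4 x)"
    and "antiderivative_on I (\<lambda>x. b x + f\<^sub>4 x) E"
    and "antiderivative_on I (\<lambda>x. c x * exp (E x)) H"
  shows "riccati_general_solution I a b c (\<lambda>x. exp (E x)) H (\<lambda>x. f\<^sub>4 x / (2 * c x))"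
proof (rule riccati_general_solution_from_particular)
  show "continuous_on I c"
    using smooth_on_has_derivative[OF assms(4)]
    by (meson DERIV_continuous continuous_on_eq_continuous_within)
  show "riccati_solution_on I a b c (\<lambda>x. f\<^sub>4 x / (2 * c x))"
    using half_quotient_solves_riccati assms(4-7) by blast
  show "antiderivative_on I (\<lambda>x. b x + 2 * c x * (f\<^sub>4 x / (2 * c x))) E"
    using assms(6,8) by (simp add: antiderivative_on_def)
  show "antiderivative_on I (\<lambda>x. c x * exp (E x)) H"
    by (fact assms(9))
qed

end
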